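(* Let $f=(\phi_1,\phi_2)\colon\mathbb{R}^2\to\mathbb{R}^2$ be a tropical algebraic map, i.e. $\phi_1,\phi_2$ are tropical algebraic functions on $\mathbb{R}^2$. Let $(f_i,C_i)$, $i=1,\dots,N$, be the linear pieces of $f$ and let $J_i$ denote the determinant of the Jacobian matrix of $f_i$. If all the $J_i$ have the same sign (i.e. either all $J_i>0$ or all $J_i<0$), then $f$ is an isomorphism.
   Context: Here "linear" means polynomial of degree at most one (constant terms are allowed). A tropical algebraic function on $\mathbb{R}^n$ is a function $\mathbb{R}^n\to\mathbb{R}$ of the form $\min\{A_1,\dots,A_s\}$, where $A_1,\dots,A_s$ are linear functions with rational coefficients (so it is concave and piecewise linear). A tropical algebraic rational function is a difference $\min\{A_1,\dots,A_k\}-\min\{B_1,\dots,B_l\}$ of two such functions, and a tropical algebraic (respectively tropical algebraic rational) map is a map each of whose coordinates is a tropical algebraic (respectively tropical algebraic rational) function. For such a map $f\colon\mathbb{R}^n\to\mathbb{R}^n$ there is a finite decomposition $\mathbb{R}^n=\bigcup_{i=1}^N C_i$ into closed $n$-dimensional (convex) polyhedra with pairwise disjoint interiors, together with linear maps $f_i$ such that $f=f_i$ on $C_i$; the pairs $(f_i,C_i)$ (or just the $f_i$) are called the linear pieces of $f$. A tropical algebraic rational map $\mathbb{R}^n\to\mathbb{R}^n$ is called an isomorphism if it is a bijection (its inverse is then also a tropical algebraic rational map). *)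

theory Defs
  imports "HOL-Analysis.Analysis"
begin

text \<open>
  Throughout, ``linear'' functions are polynomials of degree at most one. They are called affine
  here, since \<^const>\<open>linear\<close> excludes constant terms. All coefficients of a
  rational affine function, including the constant term, are rational.
\<close>

definition rational_affine_function :: "(real ^ 'n \<Rightarrow> real) \<Rightarrow> bool" where
  "rational_affine_function A \<longleftrightarrow>
     (\<exists>a c. (\<forall>i. a $ i \<in> \<rat>) \<and> c \<in> \<rat> \<and> A = (\<lambda>x. (\<Sum>i\<in>UNIV. a $ i * x $ i) + c))"

definition tropical_algebraic_function :: "(real ^ 'n \<Rightarrow> real) \<Rightarrow> bool" where
  "tropical_algebraic_function \<phi> \<longleftrightarrow>
     (\<exists>S. finite S \<and> S \<noteq> {} \<and> (\<forall>A\<in>S. rational_affine_function A) \<and>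
          \<phi> = (\<lambda>x. Min ((\<lambda>A. A x) ` S)))"

definition tropical_algebraic_rational_function :: "(real ^ 'n \<Rightarrow> real) \<Rightarrow> bool" where
  "tropical_algebraic_rational_function \<phi> \<longleftrightarrow>
     (\<exists>\<alpha> \<beta>. tropical_algebraic_function \<alpha> \<and> tropical_algebraic_function \<beta> \<and>
            \<phi> = (\<lambda>x. \<alpha> x - \<beta> x))"

definition tropical_algebraic_map :: "(real ^ 'n \<Rightarrow> real ^ 'm) \<Rightarrow> bool" where
  "tropical_algebraic_map f \<longleftrightarrow> (\<forall>j. tropical_algebraic_function (\<lambda>x. f x $ j))"

definition tropical_algebraic_rational_map :: "(real ^ 'n \<Rightarrow> real ^ 'm) \<Rightarrow> bool" where
  "tropical_algebraic_rational_map f \<longleftrightarrow>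
     (\<forall>j. tropical_algebraic_rational_function (\<lambda>x. f x $ j))"

definition tropical_isomorphism :: "(real ^ 'n \<Rightarrow> real ^ 'n) \<Rightarrow> bool" where
  "tropical_isomorphism f \<longleftrightarrow> tropical_algebraic_rational_map f \<and> bij f"

definition affine_map :: "(real ^ 'n \<Rightarrow> real ^ 'm) \<Rightarrow> bool" where
  "affine_map g \<longleftrightarrow> (\<exists>h b. linear h \<and> g = (\<lambda>x. h x + b))"

text \<open>
  A decomposition into linear pieces is not unique (cells may be subdivided), so it is a relation
  between \<open>f\<close> and an indexed family of pairs. Closedness and convexity of the cells are part of
  \<^const>\<open>polyhedron\<close>.
\<close>

definition linear_pieces ::
  "(real ^ 'n \<Rightarrow> real ^ 'n) \<Rightarrow> nat \<Rightarrow> (nat \<Rightarrow> real ^ 'n \<Rightarrow> real ^ 'n) \<Rightarrow> (nat \<Rightarrow> (real ^ 'n) set) \<Rightarrow> bool"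
  where
  "linear_pieces f N g C \<longleftrightarrow>
     (\<Union>i\<in>{1..N}. C i) = UNIV \<and>
     (\<forall>i\<in>{1..N}. polyhedron (C i) \<and> aff_dim (C i) = int CARD('n)) \<and>
     (\<forall>i\<in>{1..N}. \<forall>j\<in>{1..N}. i \<noteq> j \<longrightarrow> interior (C i) \<inter> interior (C j) = {}) \<and>
     (\<forall>i\<in>{1..N}. affine_map (g i) \<and> (\<forall>x\<in>C i. f x = g i x))"

lemma jacobian_affine:
  fixes h :: "real ^ 'n \<Rightarrow> real ^ 'm"
  assumes "linear h"
  shows "jacobian (\<lambda>x. h x + b) (at x) = matrix h"
proof -
  have "((\<lambda>x. h x + b) has_derivative h) (at x)"
    using linear_imp_has_derivative[OF assms] by (auto intro!: derivative_eq_intros)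
  then show ?thesis
    unfolding jacobian_def using frechet_derivative_at by metis
qed

text \<open>
  The Jacobian matrix of an affine map is constant by \<open>jacobian_affine\<close>, so the
  choice of the base point \<open>0\<close> is immaterial.
\<close>

definition jacobian_det :: "(real ^ 'n \<Rightarrow> real ^ 'n) \<Rightarrow> real" where
  "jacobian_det g = det (jacobian g (at 0))"

end

theory Submission
  imports Defs
begin

text \<open>
  By concavity each coordinate of \<open>f\<close> is the minimum over all pieces of the affine coordinates
  \<open>a\<^sub>i \<bullet> x + \<alpha>\<^sub>i\<close> and \<open>b\<^sub>i \<bullet> x + \<beta>\<^sub>i\<close>, and at every point a single index attains both minima.
  Passing to recession functions, the sign condition on the determinants yields a direction \<open>r\<close>
  with \<open>a\<^sub>i \<bullet> r > 0\<close> for all \<open>i\<close>. Hence every level set of the first coordinate is a graph over the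
  line orthogonal to \<open>r\<close>, and the sign condition makes the second coordinate strictly monotone along
  that graph, so \<open>f\<close> is injective. By invariance of domain its image is open; as a finite union of
  affine images of polyhedra it is also closed, so \<open>f\<close> is surjective.
\<close>

section \<open>Auxiliary facts about functions of a real variable\<close>

text \<open>Induction on the number of pieces: from \<open>x\<close>, jump to the last point
  \<open>m\<close> of a piece containing \<open>x\<close>. Beyond \<open>m\<close> that piece does
  not occur again, so the others cover the rest.\<close>

lemma strict_mono_closed_cover:
  fixes \<psi> :: "real \<Rightarrow> 'a :: order" and D :: "'i \<Rightarrow> real set"
  assumes "finite I" and "\<And>i. i \<in> I \<Longrightarrow> closed (D i)"
    and "\<And>i. i \<in> I \<Longrightarrow> strict_mono_on (D i) \<psi>"
    and "{x..y} \<subseteq> (\<Union>i\<in>I. D i)" and "x < y"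
  shows "\<psi> x < \<psi> y"
  using assms
proof (induction I arbitrary: x rule: finite_psubset_induct)
  case (psubset I)
  from psubset.prems obtain i where i: "i \<in> I" "x \<in> D i" by fastforce
  have "compact (D i \<inter> {x..y})" using psubset.prems i by (simp add: closed_Int_compact)
  moreover have "D i \<inter> {x..y} \<noteq> {}" using i psubset.prems by auto
  ultimately obtain m where m: "m \<in> D i" "x \<le> m" "m \<le> y"
    and max: "\<And>s. s \<in> D i \<Longrightarrow> x \<le> s \<Longrightarrow> s \<le> y \<Longrightarrow> s \<le> m"
    using compact_attains_sup[of "D i \<inter> {x..y}"] by fastforce
  have le: "x < m \<Longrightarrow> \<psi> x < \<psi> m"
    using psubset.prems(2)[OF i(1)] i m by (auto simp: strict_mono_on_def)
  show ?case
  proof (cases "m = y")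
    case True
    then show ?thesis using le psubset.prems by simp
  next
    case False
    then have "m < y" using m by simp
    have "{m<..y} \<subseteq> (\<Union>i\<in>I - {i}. D i)"
    proof
      fix s assume s: "s \<in> {m<..y}"
      then have "s \<in> {x..y}" using m by simp
      then obtain j where "j \<in> I" "s \<in> D j" using psubset.prems(3) by blast
      moreover have "s \<notin> D i" using s max[of s] m by fastforce
      ultimately show "s \<in> (\<Union>i\<in>I - {i}. D i)" by blast
    qed
    moreover have "closed (\<Union>i\<in>I - {i}. D i)"
      using psubset by auto
    \<comment> \<open>Taking the closure recovers the endpoint \<open>m\<close>, so the induction
      hypothesis can start there.\<close>
    ultimately have "closure {m<..y} \<subseteq> (\<Union>i\<in>I - {i}. D i)"
      by (rule closure_minimal)
    then have "{m..y} \<subseteq> (\<Union>i\<in>I - {i}. D i)" using \<open>m < y\<close> by simp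
    then have "\<psi> m < \<psi> y"
      using psubset.IH[of "I - {i}" m] psubset.prems i \<open>m < y\<close> by auto
    then show ?thesis using le m by fastforce
  qed
qed

lemma continuous_on_Min_image:
  fixes F :: "'i \<Rightarrow> 'b::topological_space \<Rightarrow> real"
  assumes "finite I" "I \<noteq> {}" "\<And>i. i \<in> I \<Longrightarrow> continuous_on S (F i)"
  shows "continuous_on S (\<lambda>x. Min ((\<lambda>i. F i x) ` I))"
  using assms by (induction I rule: finite_ne_induct) (auto intro!: continuous_on_min)

lemma continuous_on_Max_image:
  fixes F :: "'i \<Rightarrow> 'b::topological_space \<Rightarrow> real"
  assumes "finite I" "I \<noteq> {}" "\<And>i. i \<in> I \<Longrightarrow> continuous_on S (F i)"
  shows "continuous_on S (\<lambda>x. Max ((\<lambda>i. F i x) ` I))"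
  using assms by (induction I rule: finite_ne_induct) (auto intro!: continuous_on_max)

text \<open>A positive slope would eventually exceed any constant. This discards bounded terms when
  affine functions are compared along a ray.\<close>

lemma slope_nonpos_if_frequently_bounded:
  fixes d C :: real
  assumes "\<exists>\<^sub>F n in sequentially. real n * d \<le> C"
  shows "d \<le> 0"
proof (rule ccontr)
  assume "\<not> d \<le> 0"
  then have "filterlim (\<lambda>n. real n * d) at_top sequentially"
    by (intro filterlim_at_top_mult_tendsto_pos[OF tendsto_const] filterlim_real_sequentially) simp
  then have "\<forall>\<^sub>F n in sequentially. C < real n * d"
    by (simp add: filterlim_at_top_dense)
  then show False using assms by (simp add: frequently_def not_le)
qed

section \<open>Plane geometry: the determinant \<open>cross2\<close> with rows \<open>u\<close>,
  \<open>v\<close> and the quarter turn \<open>rot\<close>\<close>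

definition cross2 :: "real ^ 2 \<Rightarrow> real ^ 2 \<Rightarrow> real" where
  "cross2 u v = u $ 1 * v $ 2 - u $ 2 * v $ 1"

definition rot :: "real ^ 2 \<Rightarrow> real ^ 2" where
  "rot v = vector [- v $ 2, v $ 1]"

lemma inner_real2: "u \<bullet> v = u $ 1 * v $ 1 + u $ 2 * v $ 2" for u v :: "real ^ 2"
  by (simp add: inner_vec_def sum_2)

text \<open>Multiplicativity of the determinant: the matrix with columns \<open>v\<close>,
  \<open>rot v\<close> has determinant \<open>v \<bullet> v\<close>. Signs of \<open>cross2\<close>
  can thus be read off in this frame.\<close>

lemma cross2_in_frame: "cross2 u d * (v \<bullet> v) = (u \<bullet> v) * (d \<bullet> rot v) - (u \<bullet> rot v) * (d \<bullet> v)"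
  by (simp add: cross2_def rot_def inner_real2 algebra_simps)

lemma cross2_add_multiple: "cross2 u (v + m *\<^sub>R u) = cross2 u v"
  by (simp add: cross2_def algebra_simps)

lemma inner_rot_self [simp]: "v \<bullet> rot v = 0" "rot v \<bullet> v = 0"
  by (simp_all add: rot_def inner_real2)

lemma rot_inner_rot [simp]: "rot u \<bullet> rot v = u \<bullet> v"
  by (simp add: rot_def inner_real2)

lemma rot_eq_0_iff [simp]: "rot v = 0 \<longleftrightarrow> v = 0"
  by (metis inner_eq_zero_iff rot_inner_rot)

lemma real2_in_frame: "(v \<bullet> v) *\<^sub>R x = (x \<bullet> v) *\<^sub>R v + (x \<bullet> rot v) *\<^sub>R rot v"
  by (simp add: vec_eq_iff forall_2 rot_def inner_real2 algebra_simps)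

lemma orthogonal_real2:
  assumes "u \<bullet> x = 0"
  shows "(u \<bullet> u) *\<^sub>R x = (x \<bullet> rot u) *\<^sub>R rot u"
  using real2_in_frame[of u x] assms by (simp add: inner_commute)

section \<open>Pairs of concave piecewise affine functions on the plane\<close>

text \<open>The vectors \<open>a i\<close>, \<open>b i\<close> are the gradients of piece
  \<open>i\<close>. Only minima of affine functions appear, so the two coordinates of the map may be
  inserted in either order.\<close>

locale concave_pair =
  fixes I :: "'i set" and a b :: "'i \<Rightarrow> real ^ 2" and \<alpha> \<beta> :: "'i \<Rightarrow> real"
  assumes fin: "finite I"
    and common_min: "\<exists>i\<in>I. \<forall>j\<in>I. a i \<bullet> x + \<alpha> i \<le> a j \<bullet> x + \<alpha> j \<and> b i \<bullet> x + \<beta> i \<le> b j \<bullet> x + \<beta> j"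
    and cross_pos: "i \<in> I \<Longrightarrow> cross2 (a i) (b i) > 0"
begin

lemma nonempty: "I \<noteq> {}"
  using common_min by blast

definition minimizes :: "real ^ 2 \<Rightarrow> 'i \<Rightarrow> bool" where
  "minimizes x i \<longleftrightarrow>
     i \<in> I \<and> (\<forall>j\<in>I. a i \<bullet> x + \<alpha> i \<le> a j \<bullet> x + \<alpha> j \<and> b i \<bullet> x + \<beta> i \<le> b j \<bullet> x + \<beta> j)"

definition rec_minimizes :: "real ^ 2 \<Rightarrow> 'i \<Rightarrow> bool" where
  "rec_minimizes v i \<longleftrightarrow> i \<in> I \<and> (\<forall>j\<in>I. a i \<bullet> v \<le> a j \<bullet> v \<and> b i \<bullet> v \<le> b j \<bullet> v)"

text \<open>Pigeonhole: a single index minimizes at \<open>n v\<close> for infinitely many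
  \<open>n\<close>, and comparing slopes eliminates the constants.\<close>

lemma rec_minimizes_exists: "\<exists>i. rec_minimizes v i"
proof -
  have "\<exists>\<^sub>F n in sequentially. \<exists>i\<in>I. minimizes (real n *\<^sub>R v) i"
    using common_min by (intro eventually_frequently always_eventually) (simp_all add: minimizes_def del: inner_scaleR_right)
  from frequently_bex_finite[OF fin this] obtain i
    where i: "i \<in> I" "\<exists>\<^sub>F n in sequentially. minimizes (real n *\<^sub>R v) i"
    by blast
  have "a i \<bullet> v - a j \<bullet> v \<le> 0 \<and> b i \<bullet> v - b j \<bullet> v \<le> 0" if "j \<in> I" for j
    using that
    by (intro conjI slope_nonpos_if_frequently_bounded[where C = "\<alpha> j - \<alpha> i"]
        slope_nonpos_if_frequently_bounded[where C = "\<beta> j - \<beta> i"] frequently_mono[OF _ i(2)])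
      (auto simp: minimizes_def algebra_simps)
  then show ?thesis using i by (auto simp: rec_minimizes_def)
qed

text \<open>The directions \<open>n v + w\<close> tend to that of \<open>v\<close>, so this selects
  a piece active both on the ray of \<open>v\<close> and slightly to the side of \<open>w\<close>.
  The pigeonhole argument is the same as before.\<close>

lemma rec_minimizes_towards:
  obtains i n where "rec_minimizes v i" "n > 0" "rec_minimizes (real n *\<^sub>R v + w) i"
proof -
  have "\<exists>\<^sub>F n in sequentially. \<exists>i\<in>I. rec_minimizes (real n *\<^sub>R v + w) i"
    using rec_minimizes_exists
    by (intro eventually_frequently always_eventually) (auto simp del: inner_scaleR_right simp: rec_minimizes_def Bex_def)
  from frequently_bex_finite[OF fin this] obtain i
    where i: "i \<in> I" "\<exists>\<^sub>F n in sequentially. rec_minimizes (real n *\<^sub>R v + w) i"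
    by blast
  have "a i \<bullet> v - a j \<bullet> v \<le> 0 \<and> b i \<bullet> v - b j \<bullet> v \<le> 0" if "j \<in> I" for j
    using that
    by (intro conjI slope_nonpos_if_frequently_bounded[where C = "a j \<bullet> w - a i \<bullet> w"]
        slope_nonpos_if_frequently_bounded[where C = "b j \<bullet> w - b i \<bullet> w"] frequently_mono[OF _ i(2)])
      (auto simp: rec_minimizes_def algebra_simps)
  then have "rec_minimizes v i" using i by (auto simp: rec_minimizes_def)
  moreover have "\<exists>n>0. rec_minimizes (real n *\<^sub>R v + w) i"
    using frequently_ex[OF frequently_eventually_frequently[OF i(2) eventually_gt_at_top[of 0]]]
    by blast
  ultimately show thesis using that by blast
qed

lemma rec_minimizes_scaleR: "rec_minimizes v i \<Longrightarrow> 0 \<le> c \<Longrightarrow> rec_minimizes (c *\<^sub>R v) i"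
  by (auto simp: rec_minimizes_def mult_left_mono)

lemma exists_ascent_direction: "\<exists>r. \<forall>i\<in>I. a i \<bullet> r > 0"
proof (rule ccontr)
  assume "\<not> (\<exists>r. \<forall>i\<in>I. a i \<bullet> r > 0)"
  then have nonpos: "a i \<bullet> v \<le> 0" if "rec_minimizes v i" for v i
    using that unfolding rec_minimizes_def by (meson le_less_trans not_le less_le_trans)
  \<comment> \<open>The recession function \<open>F\<close> of the first coordinate is nonpositive. If it vanishes at some
    \<open>v \<noteq> 0\<close>, the pieces on the two sides of the ray through \<open>v\<close> have determinants of opposite sign.
    Otherwise let \<open>G\<close> be the recession function of the second coordinate; the determinant has the
    wrong sign on one side of a ray on which \<open>- G / F\<close> is maximal.\<close>
  show False
  proof (cases "\<exists>v i. v \<noteq> 0 \<and> rec_minimizes v i \<and> a i \<bullet> v = 0")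
    case True
    then obtain v k where v: "v \<noteq> 0" and k: "rec_minimizes v k" "a k \<bullet> v = 0" by blast
    have eq: "a i \<bullet> v = 0" "b i \<bullet> v = b k \<bullet> v" if "rec_minimizes v i" for i
      using that k unfolding rec_minimizes_def by (metis order_antisym)+
    \<comment> \<open>As \<open>a i \<bullet> v = 0\<close>, only one term of the determinant
      remains. The factor \<open>b k \<bullet> v\<close> is common to all such \<open>i\<close>,
      which forces one strict sign on \<open>a i \<bullet> rot v\<close>.\<close>
    have neg: "(a i \<bullet> rot v) * (b k \<bullet> v) < 0" if "rec_minimizes v i" for i
    proof -
      have "cross2 (a i) (b i) * (v \<bullet> v) > 0"
        using that cross_pos v by (auto simp: rec_minimizes_def)
      then show ?thesis by (simp add: cross2_in_frame eq[OF that])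
    qed
    obtain i n where i: "rec_minimizes v i" "rec_minimizes (real n *\<^sub>R v + rot v) i"
      by (rule rec_minimizes_towards)
    obtain j m where j: "rec_minimizes v j" "rec_minimizes (real m *\<^sub>R v + - rot v) j"
      by (rule rec_minimizes_towards)
    have "a i \<bullet> rot v \<le> 0" using nonpos[OF i(2)] eq[OF i(1)] by (simp add: inner_add_right)
    moreover have "a j \<bullet> rot v \<ge> 0" using nonpos[OF j(2)] eq[OF j(1)] by (simp add: inner_diff_right)
    ultimately show False using neg[OF i(1)] neg[OF j(1)]
      by (auto simp: mult_less_0_iff)
  next
    case False
    then have neg: "a i \<bullet> v < 0" if "rec_minimizes v i" "v \<noteq> 0" for v i
      using nonpos that by (metis order_le_less)
    define F where "F v = Min ((\<lambda>i. a i \<bullet> v) ` I)" for v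
    define G where "G v = Min ((\<lambda>i. b i \<bullet> v) ` I)" for v
    have FG: "F v = a i \<bullet> v" "G v = b i \<bullet> v" if "rec_minimizes v i" for v i
      using that fin by (auto simp: F_def G_def rec_minimizes_def intro!: Min_eqI)
    have Fneg: "F v < 0" if "v \<noteq> 0" for v
      using rec_minimizes_exists[of v] FG neg that by force
    have "continuous_on (sphere 0 1) (\<lambda>v. - G v / F v)"
    proof (intro continuous_intros)
      show "\<forall>v\<in>sphere 0 1. F v \<noteq> 0"
        using Fneg by (metis dist_0_norm less_irrefl mem_sphere norm_zero zero_neq_one)
    qed (auto simp: F_def G_def intro!: continuous_on_Min_image fin nonempty continuous_intros)
    moreover have "compact (sphere (0::real^2) 1)" "sphere (0::real^2) 1 \<noteq> {}" by auto
    ultimately obtain v where v: "v \<in> sphere 0 1"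
      and vmax: "\<And>u. u \<in> sphere 0 1 \<Longrightarrow> - G u / F u \<le> - G v / F v"
      using continuous_attains_sup by meson
    define m where "m = - G v / F v"
    have "v \<noteq> 0" using v by auto
    have vm: "G v + m * F v = 0" using Fneg[OF \<open>v \<noteq> 0\<close>] by (simp add: m_def)
    \<comment> \<open>Since \<open>F < 0\<close>, maximality of \<open>m\<close> means
      \<open>G + m F \<le> 0\<close> on the unit circle, with equality at \<open>v\<close>;
      homogeneity extends the inequality to all nonzero \<open>u\<close>.\<close>
    have le: "b i \<bullet> u + m * (a i \<bullet> u) \<le> 0" if u: "rec_minimizes u i" "u \<noteq> 0" for u i
    proof -
      define u' where "u' = inverse (norm u) *\<^sub>R u"
      have u': "rec_minimizes u' i" "u' \<in> sphere 0 1" "u' \<noteq> 0"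
        using u by (auto simp: u'_def rec_minimizes_scaleR)
      have "- G u' / F u' \<le> m" using vmax[OF u'(2)] by (simp add: m_def)
      then have "G u' + m * F u' \<le> 0" using Fneg[OF u'(3)]
        by (simp add: field_simps)
      then have "inverse (norm u) * (b i \<bullet> u + m * (a i \<bullet> u)) \<le> 0"
        using FG[OF u'(1)] by (simp add: u'_def algebra_simps)
      then show ?thesis using u(2) by (simp add: mult_le_0_iff)
    qed
    obtain i n where i: "rec_minimizes v i" "rec_minimizes (real n *\<^sub>R v + - rot v) i"
      by (rule rec_minimizes_towards)
    \<comment> \<open>Adding a multiple of \<open>a i\<close> leaves the determinant unchanged and
      makes the second row orthogonal to \<open>v\<close>. Its sign then depends only on
      \<open>a i \<bullet> v < 0\<close> and \<open>d \<bullet> rot v\<close>.\<close>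
    define d where "d = b i + m *\<^sub>R a i"
    have dv: "d \<bullet> v = 0" using vm FG[OF i(1)] by (simp add: d_def inner_add_left)
    have "real n *\<^sub>R v + - rot v \<noteq> 0"
    proof
      assume "real n *\<^sub>R v + - rot v = 0"
      then have "(real n *\<^sub>R v + - rot v) \<bullet> rot v = 0" by simp
      then show False using \<open>v \<noteq> 0\<close> by (simp add: inner_diff_left)
    qed
    from le[OF i(2) this] have "d \<bullet> (real n *\<^sub>R v + - rot v) \<le> 0"
      by (simp add: d_def inner_add_left)
    then have "d \<bullet> rot v \<ge> 0" using dv by (simp add: inner_diff_right)
    then have "cross2 (a i) d * (v \<bullet> v) \<le> 0"
      using neg[OF i(1) \<open>v \<noteq> 0\<close>] dv by (simp add: cross2_in_frame mult_le_0_iff)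
    moreover have "cross2 (a i) d > 0"
      using cross_pos i by (simp add: d_def cross2_add_multiple rec_minimizes_def)
    moreover have "v \<bullet> v > 0" using \<open>v \<noteq> 0\<close> by simp
    ultimately show False by (simp add: mult_le_0_iff del: inner_gt_zero_iff)
  qed
qed

text \<open>A vector orthogonal to \<open>a i\<close> is a multiple of \<open>rot (a i)\<close>,
  with positive factor because \<open>a i \<bullet> r\<close> and \<open>x \<bullet> rot r\<close>
  are positive. Moreover \<open>b i \<bullet> rot (a i)\<close> is the determinant.\<close>

lemma second_increases_along_level:
  assumes i: "i \<in> I" and r: "a i \<bullet> r > 0" and level: "a i \<bullet> x = 0" and x: "x \<bullet> rot r > 0"
  shows "b i \<bullet> x > 0"
proof -
  have a: "a i \<bullet> a i > 0" using r by auto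
  define k where "k = x \<bullet> rot (a i)"
  have eq: "(a i \<bullet> a i) *\<^sub>R x = k *\<^sub>R rot (a i)"
    unfolding k_def by (rule orthogonal_real2[OF level])
  have "(a i \<bullet> a i) * (x \<bullet> rot r) = k * (a i \<bullet> r)"
    using arg_cong[OF eq, of "\<lambda>y. y \<bullet> rot r"] by simp
  then have "k * (a i \<bullet> r) > 0" using a x by (metis mult_pos_pos)
  then have "k > 0" using r by (simp add: zero_less_mult_iff)
  have "(a i \<bullet> a i) * (b i \<bullet> x) = k * cross2 (a i) (b i)"
    using arg_cong[OF eq, of "\<lambda>y. b i \<bullet> y"]
    by (simp add: rot_def cross2_def inner_real2 algebra_simps)
  then have "(a i \<bullet> a i) * (b i \<bullet> x) > 0" using \<open>k > 0\<close> cross_pos[OF i] by simp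
  then show ?thesis using a by (simp add: zero_less_mult_iff)
qed

lemma injective:
  assumes p: "minimizes p i" and q: "minimizes q j"
    and P: "a i \<bullet> p + \<alpha> i = a j \<bullet> q + \<alpha> j" and Q: "b i \<bullet> p + \<beta> i = b j \<bullet> q + \<beta> j"
  shows "p = q"
proof -
  obtain r where r: "\<And>i. i \<in> I \<Longrightarrow> a i \<bullet> r > 0" using exists_ascent_direction by blast
  have r0: "r \<noteq> 0" using r nonempty by fastforce
  define w where "w = rot r"
  define c where "c = a i \<bullet> p + \<alpha> i"
  \<comment> \<open>\<open>s \<mapsto> X s\<close> parametrizes the level set of the first coordinate at height \<open>c\<close>: solving
    \<open>min\<^sub>i (a\<^sub>i \<bullet> (t r + s w) + \<alpha>\<^sub>i) = c\<close> for \<open>t\<close> gives the maximum of the solutions for the single \<open>i\<close>.\<close>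
  define T where "T s = Max ((\<lambda>i. (c - \<alpha> i - s * (a i \<bullet> w)) / (a i \<bullet> r)) ` I)" for s
  define X where "X s = T s *\<^sub>R r + s *\<^sub>R w" for s
  have contX: "continuous_on UNIV X"
    unfolding X_def T_def using fin nonempty r
    by (intro continuous_intros continuous_on_Max_image) force+
  \<comment> \<open>Each piece increases in the direction \<open>r\<close>, so taking the largest
    solution puts every piece at height at least \<open>c\<close>, and the index attaining the
    maximum exactly at \<open>c\<close>.\<close>
  have Xc: "a k \<bullet> X s + \<alpha> k = c" if k: "minimizes (X s) k" for s k
  proof -
    have kI: "k \<in> I" using k by (simp add: minimizes_def)
    have "(c - \<alpha> k - s * (a k \<bullet> w)) / (a k \<bullet> r) \<le> T s"
      using fin kI by (auto simp: T_def)
    then have "c \<le> a k \<bullet> X s + \<alpha> k"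
      using r[OF kI] by (simp add: X_def field_simps inner_add_right)
    moreover obtain l where l: "l \<in> I" "T s = (c - \<alpha> l - s * (a l \<bullet> w)) / (a l \<bullet> r)"
      using Max_in[of "(\<lambda>i. (c - \<alpha> i - s * (a i \<bullet> w)) / (a i \<bullet> r)) ` I"] fin nonempty
      unfolding T_def by blast
    have "a l \<bullet> X s + \<alpha> l = c" using r[OF l(1)] by (simp add: X_def l(2) inner_add_right)
    then have "a k \<bullet> X s + \<alpha> k \<le> c" using k l by (metis minimizes_def)
    ultimately show ?thesis by simp
  qed
  \<comment> \<open>Conversely, every point at height \<open>c\<close> lies on the curve; its
    parameter is its coordinate along \<open>w\<close>, where
    \<open>w \<bullet> w = r \<bullet> r\<close>.\<close>
  have onX: "x = X ((x \<bullet> w) / (r \<bullet> r))" if x: "minimizes x k" "a k \<bullet> x + \<alpha> k = c" for x k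
  proof -
    define s where "s = (x \<bullet> w) / (r \<bullet> r)"
    define t where "t = (x \<bullet> r) / (r \<bullet> r)"
    have "inverse (r \<bullet> r) *\<^sub>R ((r \<bullet> r) *\<^sub>R x) = t *\<^sub>R r + s *\<^sub>R w"
      unfolding real2_in_frame s_def t_def w_def by (simp add: scaleR_add_right divide_inverse mult.commute)
    then have eq: "x = t *\<^sub>R r + s *\<^sub>R w" using r0 by simp
    have "T s = t" unfolding T_def
    proof (rule Max_eqI)
      show "finite ((\<lambda>i. (c - \<alpha> i - s * (a i \<bullet> w)) / (a i \<bullet> r)) ` I)" using fin by simp
      show "y \<le> t" if "y \<in> (\<lambda>i. (c - \<alpha> i - s * (a i \<bullet> w)) / (a i \<bullet> r)) ` I" for y
      proof -
        from that obtain l where l: "l \<in> I" "y = (c - \<alpha> l - s * (a l \<bullet> w)) / (a l \<bullet> r)" by blast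
        have "c \<le> a l \<bullet> x + \<alpha> l" using x l by (metis minimizes_def)
        then show ?thesis using r[OF l(1)] by (simp add: l eq field_simps inner_add_right)
      qed
      have kI: "k \<in> I" using x by (simp add: minimizes_def)
      have "t = (c - \<alpha> k - s * (a k \<bullet> w)) / (a k \<bullet> r)"
        using x(2) r[OF kI] by (simp add: eq field_simps inner_add_right)
      then show "t \<in> (\<lambda>i. (c - \<alpha> i - s * (a i \<bullet> w)) / (a i \<bullet> r)) ` I" using kI by blast
    qed
    then show ?thesis using eq unfolding s_def[symmetric] X_def by simp
  qed
  define \<psi> where "\<psi> s = Min ((\<lambda>i. b i \<bullet> X s + \<beta> i) ` I)" for s
  have psi: "\<psi> s = b k \<bullet> X s + \<beta> k" if "minimizes (X s) k" for s k
    unfolding \<psi>_def using that fin by (intro Min_eqI) (auto simp: minimizes_def)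
  define D where "D k = {s. minimizes (X s) k}" for k
  \<comment> \<open>The parameter sets \<open>D k\<close> of the active pieces are closed and cover
    the line. Within one of them, chords of the curve are orthogonal to \<open>a k\<close>, so the
    increase is that of a single piece.\<close>
  have mono: "\<psi> s < \<psi> s'" if "s < s'" for s s'
  proof (rule strict_mono_closed_cover[OF fin _ _ _ that])
    show "closed (D k)" if "k \<in> I" for k
    proof -
      have "D k = (\<Inter>j\<in>I. {s. a k \<bullet> X s + \<alpha> k \<le> a j \<bullet> X s + \<alpha> j} \<inter> {s. b k \<bullet> X s + \<beta> k \<le> b j \<bullet> X s + \<beta> j})"
        using that by (auto simp: D_def minimizes_def)
      also have "closed \<dots>"
        by (intro closed_INT ballI closed_Int closed_Collect_le continuous_intros contX)
      finally show ?thesis .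
    qed
    show "strict_mono_on (D k) \<psi>" if k: "k \<in> I" for k
    proof (rule strict_mono_onI)
      fix s t assume D: "s \<in> D k" "t \<in> D k" and "s < t"
      have "a k \<bullet> (X t - X s) = 0" using Xc[of s k] Xc[of t k] D by (simp add: D_def inner_diff_right)
      moreover have "(X t - X s) \<bullet> rot r = (t - s) * (r \<bullet> r)"
        by (simp add: X_def w_def inner_diff_left inner_add_left algebra_simps)
      then have "(X t - X s) \<bullet> rot r > 0" using \<open>s < t\<close> r0 by simp
      ultimately have "b k \<bullet> (X t - X s) > 0"
        using second_increases_along_level[OF k r[OF k]] by blast
      then show "\<psi> s < \<psi> t" using psi[of s k] psi[of t k] D by (simp add: D_def inner_diff_right)
    qed
    show "{s..s'} \<subseteq> (\<Union>k\<in>I. D k)" using common_min by (fastforce simp: D_def minimizes_def)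
  qed
  have pX: "p = X ((p \<bullet> w) / (r \<bullet> r))" using onX[OF p] by (simp add: c_def)
  have qX: "q = X ((q \<bullet> w) / (r \<bullet> r))" using onX[OF q] P by (simp add: c_def)
  have "\<psi> ((p \<bullet> w) / (r \<bullet> r)) = \<psi> ((q \<bullet> w) / (r \<bullet> r))"
    using psi[of "(p \<bullet> w) / (r \<bullet> r)" i] psi[of "(q \<bullet> w) / (r \<bullet> r)" j] p q Q
    unfolding pX[symmetric] qX[symmetric] by simp
  then have "(p \<bullet> w) / (r \<bullet> r) = (q \<bullet> w) / (r \<bullet> r)"
    using mono by (metis less_irrefl linorder_neqE_linordered_idom)
  then show ?thesis using pX qX by metis
qed

end

section \<open>From tropical maps and their linear pieces to concave pairs\<close>

lemma tropical_algebraic_function_concave: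
  fixes \<phi> :: "real ^ 'n \<Rightarrow> real"
  assumes "tropical_algebraic_function \<phi>"
  shows "concave_on UNIV \<phi>"
proof -
  from assms obtain S where S: "finite S" "S \<noteq> {}" "\<forall>A\<in>S. rational_affine_function A"
    and \<phi>: "\<phi> = (\<lambda>x. Min ((\<lambda>A. A x) ` S))" unfolding tropical_algebraic_function_def by blast
  show ?thesis
    unfolding concave_on_def
  proof (rule convex_onI)
    fix t :: real and x y :: "real ^ 'n" assume t: "0 < t" "t < 1"
    have "\<phi> ((1 - t) *\<^sub>R x + t *\<^sub>R y) \<in> (\<lambda>A. A ((1 - t) *\<^sub>R x + t *\<^sub>R y)) ` S"
      unfolding \<phi> using S by (intro Min_in) auto
    then obtain A where A: "A \<in> S" "\<phi> ((1 - t) *\<^sub>R x + t *\<^sub>R y) = A ((1 - t) *\<^sub>R x + t *\<^sub>R y)" by blast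
    from S(3) A(1) obtain a c where "A = (\<lambda>x. (\<Sum>i\<in>UNIV. a $ i * x $ i) + c)"
      unfolding rational_affine_function_def by blast
    then have "A ((1 - t) *\<^sub>R x + t *\<^sub>R y) = (1 - t) * A x + t * A y"
      by (simp add: algebra_simps sum.distrib sum_distrib_left sum_subtractf)
    moreover have "\<phi> x \<le> A x" "\<phi> y \<le> A y" using S A by (auto simp: \<phi>)
    ultimately have "(1 - t) * \<phi> x + t * \<phi> y \<le> \<phi> ((1 - t) *\<^sub>R x + t *\<^sub>R y)"
      using A t by (auto intro!: add_mono mult_left_mono)
    then show "- \<phi> ((1 - t) *\<^sub>R x + t *\<^sub>R y) \<le> (1 - t) * - \<phi> x + t * - \<phi> y"
      by simp
  qed auto
qed

text \<open>A short step from an interior point \<open>y\<close> of \<open>C\<close> towards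
  \<open>x\<close> stays in \<open>C\<close>, where \<open>\<phi>\<close> is affine; concavity on
  the segment bounds \<open>\<phi> x\<close>. Hence every piece dominates the function
  globally.\<close>

lemma concave_le_affine_piece:
  fixes \<phi> l :: "'a::euclidean_space \<Rightarrow> real"
  assumes conc: "concave_on UNIV \<phi>" and l: "linear l"
    and C: "interior C \<noteq> {}" "\<And>y. y \<in> C \<Longrightarrow> \<phi> y = l y + c"
  shows "\<phi> x \<le> l x + c"
proof -
  obtain y e where e: "e > 0" "ball y e \<subseteq> C" using C(1) by (auto simp: mem_interior)
  \<comment> \<open>This gives \<open>t * norm (x - y) < e\<close>; the summand 1 keeps
    \<open>t < 1\<close> even when \<open>x = y\<close>.\<close>
  define t where "t = e / (e + 2 * norm (x - y) + 1)"
  have den: "e + 2 * norm (x - y) + 1 > 0" using e norm_ge_zero[of "x - y"] by linarith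
  have t: "0 < t" "t < 1" using e den norm_ge_zero[of "x - y"] unfolding t_def by (simp_all del: norm_ge_zero)
  have "t * norm (x - y) < e"
  proof -
    have "e * norm (x - y) < e * (e + 2 * norm (x - y) + 1)"
      using e norm_ge_zero[of "x - y"] by (intro mult_strict_left_mono) linarith+
    then show ?thesis using den by (simp add: t_def field_simps)
  qed
  then have "(1 - t) *\<^sub>R y + t *\<^sub>R x \<in> ball y e"
    using t by (simp add: dist_norm algebra_simps norm_minus_commute flip: scaleR_diff_right)
  then have "\<phi> ((1 - t) *\<^sub>R y + t *\<^sub>R x) = l ((1 - t) *\<^sub>R y + t *\<^sub>R x) + c"
    using C(2) e by blast
  also have "\<dots> = (1 - t) * (l y + c) + t * (l x + c)"
    by (simp add: linear_add[OF l] linear_diff[OF l] linear_scale[OF l] algebra_simps)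
  also have "l y + c = \<phi> y" using C(2)[of y] e by force
  finally have "\<phi> ((1 - t) *\<^sub>R y + t *\<^sub>R x) = (1 - t) * \<phi> y + t * (l x + c)" .
  moreover have "\<phi> ((1 - t) *\<^sub>R y + t *\<^sub>R x) \<ge> (1 - t) * \<phi> y + t * \<phi> x"
    using concave_onD[OF conc, of t y x] t by simp
  ultimately show ?thesis using t by simp
qed

text \<open>Nonzero determinants make the linear parts injective, hence images of the closed cells
  closed. The range is then clopen and nonempty in a connected space.\<close>

lemma linear_pieces_injective_imp_surj:
  fixes f :: "real ^ 'n \<Rightarrow> real ^ 'n"
  assumes lp: "linear_pieces f N g C" and det: "\<forall>i\<in>{1..N}. jacobian_det (g i) \<noteq> 0" and inj: "inj f"
  shows "surj f"
proof -
  have cover: "(\<Union>i\<in>{1..N}. C i) = UNIV"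
    and C: "\<And>i. i \<in> {1..N} \<Longrightarrow> closed (C i)"
    and g: "\<And>i. i \<in> {1..N} \<Longrightarrow> affine_map (g i)"
    and fg: "\<And>i x. i \<in> {1..N} \<Longrightarrow> x \<in> C i \<Longrightarrow> f x = g i x"
    using lp by (auto simp: linear_pieces_def polyhedron_imp_closed)
  have piece: "continuous_on (C i) f \<and> closed (f ` C i)" if i: "i \<in> {1..N}" for i
  proof -
    obtain h b where h: "linear h" "g i = (\<lambda>x. h x + b)" using g[OF i] by (auto simp: affine_map_def)
    have eq: "f ` C i = (+) b ` h ` C i" "\<And>x. x \<in> C i \<Longrightarrow> f x = h x + b"
      using fg[OF i] by (auto simp: h image_image add.commute)
    have "det (matrix h) \<noteq> 0" using bspec[OF det i] h by (simp add: jacobian_det_def jacobian_affine)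
    then have "inj h" using det_nz_iff_inj[OF h(1)] by blast
    then have "closed (h ` C i)" using C[OF i] h(1) closed_injective_linear_image by blast
    moreover have "continuous_on (C i) (\<lambda>x. h x + b)"
      by (intro continuous_intros linear_continuous_on linear_conv_bounded_linear[THEN iffD1, OF h(1)])
    then have "continuous_on (C i) f" using eq(2) by (simp cong: continuous_on_cong)
    ultimately show ?thesis by (simp add: eq(1) closed_translation)
  qed
  have "continuous_on (\<Union>i\<in>{1..N}. C i) f"
    using C piece by (intro continuous_on_closed_Union) auto
  then have "open (range f)"
    using inj unfolding cover by (intro invariance_of_domain) auto
  moreover have "range f = (\<Union>i\<in>{1..N}. f ` C i)" using cover by (auto simp flip: image_UN)
  then have "closed (range f)" using piece by (auto intro!: closed_UN)
  ultimately show ?thesis using clopen[of "range f"] by auto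
qed

lemma tropical_algebraic_map_imp_rational:
  assumes "tropical_algebraic_map f"
  shows "tropical_algebraic_rational_map f"
proof -
  have "rational_affine_function (\<lambda>x :: real ^ 'n. 0)"
    unfolding rational_affine_function_def by (intro exI[of _ 0]) auto
  then have "tropical_algebraic_function (\<lambda>x :: real ^ 'n. 0)"
    unfolding tropical_algebraic_function_def by (intro exI[of _ "{\<lambda>x. 0}"]) auto
  then show ?thesis
    using assms unfolding tropical_algebraic_map_def tropical_algebraic_rational_map_def
      tropical_algebraic_rational_function_def by force
qed

theorem theorem5:
  fixes f :: "real ^ 2 \<Rightarrow> real ^ 2"
    and N :: nat
    and g :: "nat \<Rightarrow> real ^ 2 \<Rightarrow> real ^ 2"
    and C :: "nat \<Rightarrow> (real ^ 2) set"
  assumes "tropical_algebraic_map f"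
    and "linear_pieces f N g C"
    and "(\<forall>i\<in>{1..N}. jacobian_det (g i) > 0) \<or> (\<forall>i\<in>{1..N}. jacobian_det (g i) < 0)"
  shows "tropical_isomorphism f"
proof -
  have "\<forall>i\<in>{1..N}. \<exists>h b. linear h \<and> g i = (\<lambda>x. h x + b)"
    using assms(2) by (simp add: linear_pieces_def affine_map_def)
  then obtain h t where h: "\<And>i. i \<in> {1..N} \<Longrightarrow> linear (h i)"
    and g: "\<And>i. i \<in> {1..N} \<Longrightarrow> g i = (\<lambda>x. h i x + t i)" by metis
  \<comment> \<open>\<open>A k i\<close> is the gradient of coordinate \<open>k\<close> of piece
    \<open>i\<close>.\<close>
  define A where "A k i = matrix (h i) $ k" for k :: 2 and i
  have gk: "g i x $ k = A k i \<bullet> x + t i $ k" if "i \<in> {1..N}" for i k x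
  proof -
    have "matrix (h i) *v x = h i x"
      using h[OF that] by (simp add: matrix_works linear_matrix_vector_mul_eq)
    then show ?thesis by (metis g[OF that] A_def matrix_vector_mul_component vector_add_component)
  qed
  have det: "jacobian_det (g i) = cross2 (A 1 i) (A 2 i)" if "i \<in> {1..N}" for i
    using h[OF that] by (simp add: jacobian_det_def g[OF that] jacobian_affine det_2 cross2_def A_def)
  have le: "f x $ k \<le> A k i \<bullet> x + t i $ k" if i: "i \<in> {1..N}" for i k x
  proof (rule concave_le_affine_piece[where \<phi> = "\<lambda>x. f x $ k" and C = "C i"])
    show "concave_on UNIV (\<lambda>x. f x $ k)"
      using assms(1) by (intro tropical_algebraic_function_concave) (simp add: tropical_algebraic_map_def)
    show "linear ((\<bullet>) (A k i))" by (simp add: linear_iff inner_add_right)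
    have "polyhedron (C i)" "aff_dim (C i) = int CARD(2)"
      using assms(2) i by (auto simp: linear_pieces_def)
    \<comment> \<open>Full dimension identifies the interior with the relative interior, which is
      nonempty for a nonempty convex set.\<close>
    then show "interior (C i) \<noteq> {}"
      using interior_rel_interior_gen[of "C i"] rel_interior_eq_empty[of "C i"]
        polyhedron_imp_convex[of "C i"] aff_dim_empty_eq by force
    show "f y $ k = A k i \<bullet> y + t i $ k" if "y \<in> C i" for y
      using gk[OF i] assms(2) that i by (simp add: linear_pieces_def)
  qed
  \<comment> \<open>The cell containing \<open>x\<close> serves all coordinates at once; together
    with \<open>le\<close> this yields the common minimizer.\<close>
  have attained: "\<exists>i\<in>{1..N}. \<forall>k. f x $ k = A k i \<bullet> x + t i $ k" for x
  proof -
    have "x \<in> (\<Union>i\<in>{1..N}. C i)" using assms(2) by (simp add: linear_pieces_def)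
    then obtain i where "i \<in> {1..N}" "x \<in> C i" by blast
    then show ?thesis using gk assms(2) by (metis linear_pieces_def)
  qed
  \<comment> \<open>Leaving the order of the coordinates open lets the negative case be reduced to
    the positive one by a swap, which changes the sign of \<open>cross2\<close>.\<close>
  have inj_of: "inj f"
    if sgn: "\<And>i. i \<in> {1..N} \<Longrightarrow> cross2 (A k i) (A l i) > 0" and kl: "\<And>m. m = k \<or> m = l" for k l
  proof -
    interpret concave_pair "{1..N}" "A k" "A l" "\<lambda>i. t i $ k" "\<lambda>i. t i $ l"
    proof
      fix x
      obtain i where "i \<in> {1..N}" "\<forall>k. f x $ k = A k i \<bullet> x + t i $ k" using attained by blast
      then show "\<exists>i\<in>{1..N}. \<forall>j\<in>{1..N}. A k i \<bullet> x + t i $ k \<le> A k j \<bullet> x + t j $ k \<and>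
          A l i \<bullet> x + t i $ l \<le> A l j \<bullet> x + t j $ l"
        using le by metis
    qed (use sgn in auto)
    show ?thesis
    proof (rule injI)
      fix p q assume pq: "f p = f q"
      obtain i where i: "i \<in> {1..N}" "\<forall>k. f p $ k = A k i \<bullet> p + t i $ k" using attained by blast
      obtain j where j: "j \<in> {1..N}" "\<forall>k. f q $ k = A k j \<bullet> q + t j $ k" using attained by blast
      have "minimizes p i" "minimizes q j"
        unfolding minimizes_def using i j le by metis+
      then show "p = q" using injective i j pq by metis
    qed
  qed
  have "inj f"
    using assms(3)
  proof
    assume "\<forall>i\<in>{1..N}. jacobian_det (g i) > 0"
    then show ?thesis using inj_of[of 1 2] det exhaust_2 by simp
  next
    assume "\<forall>i\<in>{1..N}. jacobian_det (g i) < 0"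
    moreover have "cross2 u v = - cross2 v u" for u v by (simp add: cross2_def)
    ultimately have "cross2 (A 2 i) (A 1 i) > 0" if "i \<in> {1..N}" for i
      using det that by (metis neg_0_less_iff_less)
    then show ?thesis using inj_of[of 2 1] exhaust_2 by blast
  qed
  moreover have "surj f"
    using linear_pieces_injective_imp_surj[OF assms(2) _ \<open>inj f\<close>] assms(3) by fastforce
  ultimately show ?thesis
    using tropical_algebraic_map_imp_rational[OF assms(1)] by (simp add: tropical_isomorphism_def bij_def)
qed

end
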